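(* Let $K\ge 1$ be an odd integer, $\epsilon\ge 0$, and $m\in\{1,2,\dots,K\}$. Let $M_1,\dots,M_K$ be $\epsilon$-differentially private mechanisms with outputs in $\{0,1\}$ that are i.i.d., i.e. on each dataset $\mathcal D$ the outputs $M_1(\mathcal D),\dots,M_K(\mathcal D)$ are independent and identically distributed. Define the noise function $\gamma:\{0,1,\dots,K\}\to[0,1]$ as follows. If $m\ge \frac{K+1}{2}$, let $\gamma(l)=1$ for all $l$. If $m\le\frac{K-1}{2}$, let $$\gamma(l)=\begin{cases}1-2h(l) & \text{if } l\le \frac{K-1}{2},\\ 2h(l)-1 & \text{if } l\ge\frac{K+1}{2},\end{cases}\qquad h(l)=\sum_{i=m}^{2m-1}\frac{\binom{l}{i}\binom{K-l}{2m-1-i}}{\binom{K}{2m-1}}.$$ Then the algorithm $\mathsf{DaRRM}_\gamma$ applied to $M_1,\dots,M_K$ is $m\epsilon$-differentially private (that is, $(m\epsilon,0)$-differentially private).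
   Context: Differential privacy: a randomized mechanism $\mathcal M$ on datasets is $(\epsilon,\delta)$-differentially private if for every pair of adjacent datasets $\mathcal D,\mathcal D'$ (differing in one entry; adjacency is symmetric) and every set $S$ of outputs, $\Pr[\mathcal M(\mathcal D)\in S]\le e^{\epsilon}\Pr[\mathcal M(\mathcal D')\in S]+\delta$; "$\epsilon$-differentially private" means $\delta=0$. Algorithm $\mathsf{DaRRM}_\gamma$ (data-dependent randomized response majority) with noise function $\gamma:\{0,\dots,K\}\to[0,1]$: on a dataset $\mathcal D$, draw independently $S_i\sim M_i(\mathcal D)\in\{0,1\}$ for $i=1,\dots,K$, set $\mathcal L=\sum_{i=1}^K S_i$; with probability $\gamma(\mathcal L)$ output $\mathbf 1\{\mathcal L/K\ge 1/2\}$, and otherwise output a uniformly random bit in $\{0,1\}$. Binomial coefficients $\binom{a}{b}$ are $0$ when $b>a\geq 0$. *)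

theory Defs
  imports "HOL-Probability.Probability" "HOL-Library.Monad_Syntax"
begin

text \<open>
  Datasets are the elements of an arbitrary type \<open>'d\<close> carrying an adjacency relation; the intended
  one, "differing in one entry", is a symmetric relation.
\<close>

definition differentially_private ::
  "('d \<Rightarrow> 'd \<Rightarrow> bool) \<Rightarrow> real \<Rightarrow> real \<Rightarrow> ('d \<Rightarrow> 'o pmf) \<Rightarrow> bool" where
  "differentially_private adj \<epsilon> \<delta> M \<longleftrightarrow>
     (\<forall>D D'. adj D D' \<longrightarrow>
       (\<forall>S. measure_pmf.prob (M D) S \<le> exp \<epsilon> * measure_pmf.prob (M D') S + \<delta>))"

text \<open>
  Bits are encoded as booleans. The product distribution over \<open>{1..K}\<close> draws the \<open>K\<close> outputs
  independently. Note that \<^const>\<open>bernoulli_pmf\<close> clamps its argument to the unit interval, so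
  this is the intended algorithm only if \<open>\<gamma>\<close> maps \<open>{0..K}\<close> into \<open>{0..1}\<close>.
\<close>

definition darrm ::
  "nat \<Rightarrow> (nat \<Rightarrow> real) \<Rightarrow> (nat \<Rightarrow> 'd \<Rightarrow> bool pmf) \<Rightarrow> 'd \<Rightarrow> bool pmf" where
  "darrm K \<gamma> M D = do {
     S \<leftarrow> Pi_pmf {1..K} False (\<lambda>i. M i D);
     let L = (\<Sum>i = 1..K. of_bool (S i) :: nat);
     b \<leftarrow> bernoulli_pmf (\<gamma> L);
     if b then return_pmf (real L / real K \<ge> 1 / 2) else pmf_of_set (UNIV :: bool set)
   }"

definition subsample_h :: "nat \<Rightarrow> nat \<Rightarrow> nat \<Rightarrow> real" where
  "subsample_h K m l =
     (\<Sum>i = m..2 * m - 1.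
        real (l choose i) * real ((K - l) choose (2 * m - 1 - i)) / real (K choose (2 * m - 1)))"

text \<open>
  Only used for odd \<open>K\<close> and \<open>l \<le> K\<close>, where the divisions by 2 are exact and
  \<open>K - l\<close> does not truncate.
\<close>

definition subsample_noise :: "nat \<Rightarrow> nat \<Rightarrow> nat \<Rightarrow> real" where
  "subsample_noise K m l =
     (if m \<ge> (K + 1) div 2 then 1
      else if l \<le> (K - 1) div 2 then 1 - 2 * subsample_h K m l
      else 2 * subsample_h K m l - 1)"

end

theory Submission
  imports Defs
begin

text \<open>
  On \<open>l\<close> ones, the algorithm outputs 1 with probability \<open>h(l)\<close>, the probability that a uniformly
  random \<open>(2m-1)\<close>-subset of the \<open>K\<close> outputs has a majority of ones. As the outputs are i.i.d., such a
  subset is as good as \<open>2m-1\<close> fresh samples, so the output is the majority vote of \<open>2m-1\<close> (or of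
  \<open>K \<le> 2m-1\<close>) samples from \<open>M\<^sub>1\<close>. With \<open>t\<close> the majority threshold, a bit has output probability
  \<open>P(Bin(2t-1,p) \<ge> t)\<close>, where \<open>p\<close> is its probability under \<open>M\<^sub>1\<close>. This tail is increasing in
  \<open>p\<close>, and increasing \<open>p\<close> by a factor of at most \<open>c\<close> increases it by a factor of at most \<open>c\<^sup>t\<close>.
\<close>

section \<open>Binomial tails and their dependence on the success probability\<close>

definition binomial_tail :: "nat \<Rightarrow> nat \<Rightarrow> real \<Rightarrow> real" where
  "binomial_tail n t p = measure_pmf.prob (binomial_pmf n p) {t..}"

lemma binomial_tail_eq_sum:
  assumes "0 \<le> p" "p \<le> 1"
  shows "binomial_tail n t p = (\<Sum>i=t..n. real (n choose i) * p ^ i * (1 - p) ^ (n - i))"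
proof -
  have "binomial_tail n t p = measure_pmf.prob (binomial_pmf n p) ({t..} \<inter> {..n})"
    unfolding binomial_tail_def using set_pmf_binomial_eq[of p n] assms
    by (intro measure_prob_cong_0) (auto simp: set_pmf_iff)
  also have "{t..} \<inter> {..n} = {t..n}"
    by auto
  finally show ?thesis
    using assms by (simp add: measure_measure_pmf_finite)
qed

lemma binomial_tail_0 [simp]: "binomial_tail n 0 p = 1"
proof -
  have "{0::nat..} = UNIV"
    by auto
  then show ?thesis
    by (simp add: binomial_tail_def)
qed

lemma binomial_tail_0_Suc [simp]: "0 \<le> p \<Longrightarrow> p \<le> 1 \<Longrightarrow> binomial_tail 0 (Suc t) p = 0"
  by (simp add: binomial_tail_eq_sum)

lemma binomial_tail_nonneg [simp]: "0 \<le> binomial_tail n t p"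
  by (simp add: binomial_tail_def)

lemma binomial_tail_antimono: "s \<le> t \<Longrightarrow> binomial_tail n t p \<le> binomial_tail n s p"
  unfolding binomial_tail_def by (intro measure_pmf.finite_measure_mono) auto

text \<open>Condition on the first trial: a success leaves \<open>t\<close> more successes to find,
  a failure still \<open>Suc t\<close>.\<close>

lemma binomial_tail_Suc_Suc:
  assumes "0 \<le> p" "p \<le> 1"
  shows "binomial_tail (Suc n) (Suc t) p
    = p * binomial_tail n t p + (1 - p) * binomial_tail n (Suc t) p"
proof -
  \<comment> \<open>Writing the tail as the mass of \<open>True\<close> lets the recursive form of
    the binomial distribution be unfolded inside the monad.\<close>
  have tail: "binomial_tail n t p = pmf (map_pmf (\<lambda>k. t \<le> k) (binomial_pmf n p)) True" for n t
    by (simp add: binomial_tail_def pmf_map vimage_def atLeast_def)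
  show ?thesis
    using assms unfolding tail
    by (simp add: binomial_pmf_Suc map_pmf_def bind_assoc_pmf bind_return_pmf
        pmf_bind[of "bernoulli_pmf p"])
qed

text \<open>Induction over the trials, conditioning on the first. A success costs one factor
  \<open>c\<close> and lowers the threshold by one; a failure costs none, because
  \<open>p' \<le> p\<close> gives \<open>1 - p \<le> 1 - p'\<close>.\<close>

lemma binomial_tail_le_power_mult:
  assumes "0 \<le> p'" "p' \<le> p" "p \<le> 1" "p \<le> c * p'" "0 \<le> c"
  shows "binomial_tail n t p \<le> c ^ t * binomial_tail n t p'"
proof (induction n arbitrary: t)
  case 0
  then show ?case
    using assms by (cases t) simp_all
next
  case (Suc n)
  show ?case
  proof (cases t)
    case 0
    then show ?thesis
      by simp
  next
    case (Suc s)
    have "p * binomial_tail n s p \<le> (c * p') * (c ^ s * binomial_tail n s p')"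
      using assms Suc.IH by (intro mult_mono) auto
    moreover have "(1 - p) * binomial_tail n t p \<le> (1 - p') * (c ^ t * binomial_tail n t p')"
      using assms Suc.IH by (intro mult_mono) auto
    ultimately show ?thesis
      using assms Suc by (simp add: binomial_tail_Suc_Suc algebra_simps)
  qed
qed

lemma binomial_tail_mono:
  assumes "0 \<le> p" "p \<le> p'" "p' \<le> 1"
  shows "binomial_tail n t p \<le> binomial_tail n t p'"
proof (induction n arbitrary: t)
  case 0
  then show ?case
    using assms by (cases t) simp_all
next
  case (Suc n)
  show ?case
  proof (cases t)
    case 0
    then show ?thesis
      by simp
  next
    case (Suc s)
    have "binomial_tail (Suc n) t p \<le> p * binomial_tail n s p' + (1 - p) * binomial_tail n t p'"
      unfolding Suc using assms Suc.IH
      by (subst binomial_tail_Suc_Suc) (auto intro!: add_mono mult_left_mono)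
    also have "\<dots> = binomial_tail n t p' + p * (binomial_tail n s p' - binomial_tail n t p')"
      by (simp add: algebra_simps)
    \<comment> \<open>The expression is affine in the bias of the first trial, with slope
      nonnegative since \<open>s \<le> t\<close>.\<close>
    also have "\<dots> \<le> binomial_tail n t p' + p' * (binomial_tail n s p' - binomial_tail n t p')"
      using assms Suc by (intro add_left_mono mult_right_mono) (auto simp: binomial_tail_antimono)
    also have "\<dots> = binomial_tail (Suc n) t p'"
      using assms Suc by (simp add: binomial_tail_Suc_Suc algebra_simps)
    finally show ?thesis .
  qed
qed

lemma binomial_tail_le_power_mult':
  assumes "0 \<le> p" "p \<le> 1" "0 \<le> p'" "p' \<le> 1" "p \<le> c * p'" "1 \<le> c"
  shows "binomial_tail n t p \<le> c ^ t * binomial_tail n t p'"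
proof (cases "p' \<le> p")
  case True
  with assms show ?thesis
    by (intro binomial_tail_le_power_mult) auto
next
  case False
  then have "binomial_tail n t p \<le> 1 * binomial_tail n t p'"
    using assms by (simp add: binomial_tail_mono)
  also have "\<dots> \<le> c ^ t * binomial_tail n t p'"
    using assms by (intro mult_right_mono) auto
  finally show ?thesis .
qed

text \<open>An odd number \<open>n = 2 * t - 1\<close> of trials has no ties: either at least
  \<open>t\<close> successes or at least \<open>t\<close> failures occur. The reflection of
  \<open>i\<close> to \<open>n - i\<close> swaps the two halves of the sum.\<close>

lemma binomial_tail_majority_complement:
  assumes "Suc n = 2 * t" "0 \<le> p" "p \<le> 1"
  shows "binomial_tail n t (1 - p) = 1 - binomial_tail n t p"
proof -
  let ?a = "\<lambda>i. real (n choose i) * p ^ i * (1 - p) ^ (n - i)"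
  have "1 = binomial_tail n 0 p"
    by simp
  also have "\<dots> = sum ?a {0..n}"
    using assms by (subst binomial_tail_eq_sum) auto
  also have "{0..n} = {0..<t} \<union> {t..n}"
    using assms(1) by auto
  also have "sum ?a ({0..<t} \<union> {t..n}) = sum ?a {0..<t} + sum ?a {t..n}"
    by (intro sum.union_disjoint) auto
  also have "sum ?a {t..n} = binomial_tail n t p"
    using assms by (simp add: binomial_tail_eq_sum)
  also have "sum ?a {0..<t}
    = (\<Sum>i=t..n. real (n choose i) * (1 - p) ^ i * (1 - (1 - p)) ^ (n - i))"
    using assms(1)
    by (intro sum.reindex_bij_witness[of _ "\<lambda>i. n - i" "\<lambda>i. n - i"])
       (auto simp: binomial_symmetric[symmetric])
  also have "\<dots> = binomial_tail n t (1 - p)"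
    using assms by (subst binomial_tail_eq_sum) auto
  finally show ?thesis
    by simp
qed

section \<open>Sampling without replacement\<close>

text \<open>Counts the \<open>n\<close>-subsets of \<open>a\<close> ones and \<open>b\<close> zeros
  that contain at least \<open>m\<close> ones; left unnormalised so that the identities live in the
  naturals.\<close>

definition hypergeometric_tail :: "nat \<Rightarrow> nat \<Rightarrow> nat \<Rightarrow> nat \<Rightarrow> nat" where
  "hypergeometric_tail n m a b = (\<Sum>i=m..n. (a choose i) * (b choose (n - i)))"

text \<open>Turn one zero into a one: the samples that newly reach \<open>Suc m\<close> ones are
  those containing this element and exactly \<open>m\<close> of the other ones. The proof is a
  downward induction on \<open>m\<close>.\<close>

lemma hypergeometric_tail_Suc:
  assumes "m \<le> n"
  shows "hypergeometric_tail (Suc n) (Suc m) (Suc a) b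
    = hypergeometric_tail (Suc n) (Suc m) a (Suc b) + (a choose m) * (b choose (n - m))"
  using assms
proof (induction rule: inc_induct)
  case base
  then show ?case
    by (simp add: hypergeometric_tail_def)
next
  case (step m)
  have split: "hypergeometric_tail (Suc n) (Suc m) a b
    = (a choose Suc m) * (b choose (n - m)) + hypergeometric_tail (Suc n) (Suc (Suc m)) a b" for a b
    using step.hyps by (simp add: hypergeometric_tail_def sum.atLeast_Suc_atMost[of "Suc m"])
  \<comment> \<open>Exposes the successor so that Pascal's rule splits
    \<open>Suc b choose (n - m)\<close>.\<close>
  obtain d where "n - m = Suc d" "n - Suc m = d"
    using step.hyps by (metis Suc_diff_Suc)
  then show ?case
    using step.IH by (simp add: split algebra_simps)
qed

lemma hypergeometric_tail_mono:
  assumes "l \<le> l'" "l' \<le> K" "m \<le> n" "0 < m"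
  shows "hypergeometric_tail n m l (K - l) \<le> hypergeometric_tail n m l' (K - l')"
  using assms(1,2)
proof (induction rule: dec_induct)
  case base
  then show ?case
    by simp
next
  case (step l')
  obtain n1 m1 where "n = Suc n1" "m = Suc m1" "m1 \<le> n1"
    using assms by (cases n; cases m) auto
  then have "hypergeometric_tail n m l' (Suc (K - Suc l'))
      \<le> hypergeometric_tail n m (Suc l') (K - Suc l')"
    by (simp add: hypergeometric_tail_Suc)
  moreover have "Suc (K - Suc l') = K - l'"
    using step.prems by simp
  ultimately show ?case
    using step by simp
qed

lemma hypergeometric_tail_majority_complement:
  assumes "Suc n = 2 * m"
  shows "hypergeometric_tail n m a b + hypergeometric_tail n m b a = (a + b) choose n"
proof -
  have "hypergeometric_tail n m b a = (\<Sum>i=0..<m. (a choose i) * (b choose (n - i)))"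
    unfolding hypergeometric_tail_def using assms
    by (intro sum.reindex_bij_witness[of _ "\<lambda>i. n - i" "\<lambda>i. n - i"]) auto
  then have "hypergeometric_tail n m a b + hypergeometric_tail n m b a
      = (\<Sum>i\<in>{0..<m} \<union> {m..n}. (a choose i) * (b choose (n - i)))"
    unfolding hypergeometric_tail_def by (subst sum.union_disjoint) auto
  also have "{0..<m} \<union> {m..n} = {..n}"
    using assms by auto
  finally show ?thesis
    by (simp add: vandermonde)
qed

text \<open>Both sides are the multinomial coefficient
  \<open>(i + j + r + s)! / (i! j! r! s!)\<close>: split by value and then by sampled or not, or in
  the other order.\<close>

lemma binomial_mult_hypergeometric:
  "((i + j + (r + s)) choose (i + j)) * ((i + j) choose i) * ((r + s) choose r)
    = ((i + r + (j + s)) choose (i + r)) * ((i + r) choose i) * ((j + s) choose j)"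
proof -
  have "real (((i + j + (r + s)) choose (i + j)) * ((i + j) choose i) * ((r + s) choose r))
    = real (((i + r + (j + s)) choose (i + r)) * ((i + r) choose i) * ((j + s) choose j))"
    by (simp add: binomial_fact field_simps ac_simps)
  then show ?thesis
    by (rule of_nat_eq_iff[THEN iffD1])
qed

text \<open>The number of successes in an \<open>n\<close>-subsample of \<open>K\<close> independent
  trials is again binomial. Here \<open>i\<close> and \<open>r\<close> count successes and failures
  inside the sample, \<open>j\<close> and \<open>s\<close> those outside.\<close>

lemma binomial_hypergeometric_mixture:
  fixes p :: real
  assumes "i \<le> n" "n \<le> K"
  shows "(\<Sum>l\<le>K. real (K choose l) * p ^ l * (1 - p) ^ (K - l)
      * (real (l choose i) * real ((K - l) choose (n - i))))
    = real (K choose n) * (real (n choose i) * p ^ i * (1 - p) ^ (n - i))"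
    (is "sum ?f {..K} = ?rhs")
proof -
  define r where "r = n - i"
  have n: "n = i + r"
    using assms by (simp add: r_def)
  have summand: "?f (i + j)
      = ?rhs * (real ((K - n) choose j) * p ^ j * (1 - p) ^ (K - n - j))" if "j \<le> K - n" for j
  proof -
    obtain s where s: "K - n = j + s"
      using \<open>j \<le> K - n\<close> le_Suc_ex by blast
    then have K: "K = i + j + (r + s)"
      using n assms by simp
    show ?thesis
      using arg_cong[OF binomial_mult_hypergeometric[of i j r s], of real]
      by (simp add: s n K power_add ac_simps)
  qed
  have "sum ?f {..K} = sum ?f ((+) i ` {..K - n})"
  proof (intro sum.mono_neutral_right ballI)
    fix l assume l: "l \<in> {..K} - (+) i ` {..K - n}"
    \<comment> \<open>Too few successes or too few failures to fill the sample, so one binomial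
      coefficient vanishes.\<close>
    have "l < i \<or> K - l < n - i"
    proof (rule ccontr)
      assume "\<not> ?thesis"
      then have "l = i + (l - i)" "l - i \<le> K - n"
        using l n assms by auto
      then show False
        using l by blast
    qed
    then show "?f l = 0"
      by auto
  qed (use assms in auto)
  also have "\<dots> = (\<Sum>j\<le>K - n. ?f (i + j))"
    by (subst sum.reindex) (auto simp: inj_on_def)
  also have "\<dots> = (\<Sum>j\<le>K - n. ?rhs * (real ((K - n) choose j) * p ^ j * (1 - p) ^ (K - n - j)))"
    by (intro sum.cong summand) auto
  \<comment> \<open>The unsampled trials contribute their total mass, which is 1.\<close>
  also have "\<dots> = ?rhs * (p + (1 - p)) ^ (K - n)"
    unfolding binomial_ring by (simp only: sum_distrib_left)
  finally show ?thesis
    by simp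
qed

section \<open>Majority of a random subsample and the range of the noise\<close>

lemma subsample_h_eq:
  "subsample_h K m l
    = real (hypergeometric_tail (2 * m - 1) m l (K - l)) / real (K choose (2 * m - 1))"
  by (simp add: subsample_h_def hypergeometric_tail_def sum_divide_distrib)

lemma expectation_subsample_h:
  assumes "2 * m - 1 \<le> K" "0 \<le> p" "p \<le> 1"
  shows "measure_pmf.expectation (binomial_pmf K p) (subsample_h K m) = binomial_tail (2 * m - 1) m p"
proof -
  let ?n = "2 * m - 1"
  let ?b = "\<lambda>l. real (K choose l) * p ^ l * (1 - p) ^ (K - l)"
  have "measure_pmf.expectation (binomial_pmf K p) (subsample_h K m)
      = (\<Sum>l\<le>K. ?b l * subsample_h K m l)"
    using assms by (subst expectation_binomial_pmf') auto
  also have "\<dots> = (\<Sum>l\<le>K. \<Sum>i=m..?n. ?b l * (real (l choose i) * real ((K - l) choose (?n - i))))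
      / real (K choose ?n)"
    by (simp add: subsample_h_def sum_distrib_left sum_divide_distrib)
  also have "(\<Sum>l\<le>K. \<Sum>i=m..?n. ?b l * (real (l choose i) * real ((K - l) choose (?n - i))))
      = (\<Sum>i=m..?n. \<Sum>l\<le>K. ?b l * (real (l choose i) * real ((K - l) choose (?n - i))))"
    by (rule sum.swap)
  also have "\<dots> = (\<Sum>i=m..?n. real (K choose ?n) * (real (?n choose i) * p ^ i * (1 - p) ^ (?n - i)))"
    using assms by (intro sum.cong refl binomial_hypergeometric_mixture) auto
  also have "\<dots> / real (K choose ?n) = binomial_tail ?n m p"
    using assms by (simp add: binomial_tail_eq_sum sum_distrib_left[symmetric])
  finally show ?thesis .
qed

lemma subsample_h_complement:
  assumes "0 < m" "2 * m - 1 \<le> K" "l \<le> K"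
  shows "subsample_h K m l + subsample_h K m (K - l) = 1"
proof -
  have "hypergeometric_tail (2 * m - 1) m l (K - l) + hypergeometric_tail (2 * m - 1) m (K - l) l
      = K choose (2 * m - 1)"
    using hypergeometric_tail_majority_complement[of "2 * m - 1" m l "K - l"] assms by simp
  from arg_cong[OF this, of real] show ?thesis
    using assms by (simp add: subsample_h_eq add_divide_distrib[symmetric])
qed

lemma subsample_h_mono:
  assumes "0 < m" "l \<le> l'" "l' \<le> K"
  shows "subsample_h K m l \<le> subsample_h K m l'"
  unfolding subsample_h_eq using assms
  by (intro divide_right_mono) (auto intro!: hypergeometric_tail_mono)

text \<open>Since \<open>h(l)\<close> and \<open>h(K - l)\<close> add up to 1 and \<open>h\<close>
  is increasing, \<open>h\<close> is at most 1/2 on the lower half of the range and at least 1/2 on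
  the upper half.\<close>

lemma subsample_noise_bounds:
  assumes "odd K" "0 < m" "l \<le> K"
  shows "subsample_noise K m l \<in> {0..1}"
proof (cases "m \<ge> (K + 1) div 2")
  case True
  then show ?thesis
    by (simp add: subsample_noise_def)
next
  case False
  have sum: "subsample_h K m l + subsample_h K m (K - l) = 1"
    using False assms by (intro subsample_h_complement) auto
  have nonneg: "subsample_h K m l' \<ge> 0" for l'
    by (simp add: subsample_h_eq)
  show ?thesis
  proof (cases "l \<le> (K - 1) div 2")
    case True
    then have "subsample_h K m l \<le> subsample_h K m (K - l)"
      using assms by (intro subsample_h_mono) auto
    then show ?thesis
      using False True sum nonneg[of l] by (simp add: subsample_noise_def)
  next
    case l: False
    then have "subsample_h K m (K - l) \<le> subsample_h K m l"
      using assms by (intro subsample_h_mono) auto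
    then show ?thesis
      using False l sum nonneg[of "K - l"] by (simp add: subsample_noise_def)
  qed
qed

section \<open>Output distribution of the algorithm\<close>

lemma bool_pmf_eq_bernoulli: "(M :: bool pmf) = bernoulli_pmf (pmf M True)"
proof (rule pmf_eqI)
  show "pmf M b = pmf (bernoulli_pmf (pmf M True)) b" for b
    by (cases b) (simp_all add: pmf_le_1 pmf_False_conv_True)
qed

lemma darrm_eq_binomial:
  assumes "\<And>i. i \<in> {1..K} \<Longrightarrow> M i D = bernoulli_pmf p" "0 \<le> p" "p \<le> 1"
  shows "darrm K \<gamma> M D = do {
     L \<leftarrow> binomial_pmf K p;
     b \<leftarrow> bernoulli_pmf (\<gamma> L);
     if b then return_pmf (real L / real K \<ge> 1 / 2) else pmf_of_set (UNIV :: bool set)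
   }"
proof -
  have "(\<Sum>i = 1..K. of_bool (S i) :: nat) = card {i \<in> {1..K}. S i}" for S
    by (simp add: Int_def)
  moreover have "Pi_pmf {1..K} False (\<lambda>i. M i D) = Pi_pmf {1..K} False (\<lambda>_. bernoulli_pmf p)"
    using assms by (intro Pi_pmf_cong) auto
  moreover have "binomial_pmf K p
      = map_pmf (\<lambda>S. card {i \<in> {1..K}. S i}) (Pi_pmf {1..K} False (\<lambda>_. bernoulli_pmf p))"
    using assms by (intro binomial_pmf_altdef') auto
  ultimately show ?thesis
    by (simp only: darrm_def bind_map_pmf Let_def)
qed

text \<open>Given \<open>l\<close> ones, the majority bit has weight \<open>\<gamma> l\<close> and
  the fair coin the rest; the range of \<open>\<gamma>\<close> keeps \<open>bernoulli_pmf\<close>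
  from clamping.\<close>

lemma pmf_darrm_True:
  assumes "\<And>i. i \<in> {1..K} \<Longrightarrow> M i D = bernoulli_pmf p" "0 \<le> p" "p \<le> 1"
    and "\<And>l. l \<le> K \<Longrightarrow> \<gamma> l \<in> {0..1}"
  shows "pmf (darrm K \<gamma> M D) True = measure_pmf.expectation (binomial_pmf K p)
    (\<lambda>l. of_bool (real l / real K \<ge> 1 / 2) * \<gamma> l + (1 - \<gamma> l) / 2)"
proof -
  have le: "l \<le> K" if "l \<in> set_pmf (binomial_pmf K p)" for l
    using that assms(2,3) by (auto simp: set_pmf_binomial_eq split: if_splits)
  have darrm: "darrm K \<gamma> M D = do {
     L \<leftarrow> binomial_pmf K p;
     b \<leftarrow> bernoulli_pmf (\<gamma> L);
     if b then return_pmf (real L / real K \<ge> 1 / 2) else pmf_of_set (UNIV :: bool set)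
   }"
    using assms(1-3) by (rule darrm_eq_binomial)
  show ?thesis
    unfolding darrm pmf_bind[of "binomial_pmf K p"]
    using le assms(4)
    by (intro integral_cong_AE) (auto simp: AE_measure_pmf_iff pmf_bind indicator_def)
qed

text \<open>The minimum in \<open>t\<close> merges the two regimes: a vote of all \<open>K\<close>
  outputs, or of a subsample of size \<open>2 * m - 1\<close>. Covering both bits by one formula
  lets one tail comparison prove privacy.\<close>

lemma pmf_darrm_subsample_noise:
  assumes "odd K" "0 < m" and M: "\<And>i. i \<in> {1..K} \<Longrightarrow> M i D = N"
  defines "t \<equiv> min m ((K + 1) div 2)"
  shows "pmf (darrm K (subsample_noise K m) M D) b = binomial_tail (2 * t - 1) t (pmf N b)"
proof -
  define p where "p = pmf N True"
  have p: "0 \<le> p" "p \<le> 1"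
    by (simp_all add: p_def pmf_le_1)
  have maj: "real l / real K \<ge> 1 / 2 \<longleftrightarrow> (K + 1) div 2 \<le> l" for l
  proof -
    have "real l / real K \<ge> 1 / 2 \<longleftrightarrow> real K \<le> real (2 * l)"
      using \<open>odd K\<close> by (auto simp: field_simps odd_pos)
    also have "\<dots> \<longleftrightarrow> (K + 1) div 2 \<le> l"
      unfolding of_nat_le_iff using \<open>odd K\<close> by (auto elim!: oddE)
    finally show ?thesis .
  qed
  have "pmf (darrm K (subsample_noise K m) M D) True = measure_pmf.expectation (binomial_pmf K p)
    (\<lambda>l. of_bool ((K + 1) div 2 \<le> l) * subsample_noise K m l + (1 - subsample_noise K m l) / 2)"
    unfolding maj[symmetric]
  proof (rule pmf_darrm_True[OF _ p])
    show "M i D = bernoulli_pmf p" if "i \<in> {1..K}" for i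
      using M[OF that] bool_pmf_eq_bernoulli[of N] by (simp add: p_def)
  qed (use assms(1,2) in \<open>rule subsample_noise_bounds\<close>)
  also have "\<dots> = binomial_tail (2 * t - 1) t p"
  proof (cases "m \<ge> (K + 1) div 2")
    case True
    have "measure_pmf.expectation (binomial_pmf K p)
        (\<lambda>l. of_bool ((K + 1) div 2 \<le> l) * subsample_noise K m l + (1 - subsample_noise K m l) / 2)
      = measure_pmf.expectation (binomial_pmf K p) (indicator {(K + 1) div 2..})"
      using True by (intro Bochner_Integration.integral_cong) (auto simp: subsample_noise_def)
    then show ?thesis
      using True \<open>odd K\<close> by (auto simp: binomial_tail_def t_def min_def elim!: oddE)
  next
    case False
    \<comment> \<open>The noise is designed for this: \<open>(1 - \<gamma>) / 2\<close> on the lower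
      half and \<open>(1 + \<gamma>) / 2\<close> on the upper half both equal
      \<open>h\<close>.\<close>
    have "(\<lambda>l. of_bool ((K + 1) div 2 \<le> l) * subsample_noise K m l + (1 - subsample_noise K m l) / 2)
      = subsample_h K m"
      using False \<open>odd K\<close> by (auto simp: subsample_noise_def fun_eq_iff field_simps elim!: oddE)
    then show ?thesis
      using False p by (simp add: expectation_subsample_h t_def)
  qed
  finally have pmf_True: "pmf (darrm K (subsample_noise K m) M D) True = binomial_tail (2 * t - 1) t p" .
  show ?thesis
  proof (cases b)
    case True
    then show ?thesis
      using pmf_True by (simp add: p_def)
  next
    case False
    \<comment> \<open>Holds as \<open>t > 0\<close>; the number of votes is odd, so
      \<open>False\<close> wins exactly when \<open>True\<close> does not.\<close>
    have "Suc (2 * t - 1) = 2 * t"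
      using assms by (auto simp: t_def elim!: oddE)
    from binomial_tail_majority_complement[OF this p] show ?thesis
      using False pmf_True by (simp add: p_def pmf_False_conv_True)
  qed
qed

section \<open>Privacy through pointwise bounds\<close>

lemma differentially_private_pmf:
  assumes "differentially_private adj \<epsilon> 0 M" "adj D D'"
  shows "pmf (M D) x \<le> exp \<epsilon> * pmf (M D') x"
  using assms unfolding differentially_private_def
  by (metis add.right_neutral measure_pmf_single)

text \<open>With \<delta> = 0, bounds on single outputs add up over any finite set of outputs
  without loss.\<close>

lemma differentially_privateI_pmf:
  fixes M :: "'d \<Rightarrow> 'o :: finite pmf"
  assumes "\<And>D D' x. adj D D' \<Longrightarrow> pmf (M D) x \<le> exp \<epsilon> * pmf (M D') x"
  shows "differentially_private adj \<epsilon> 0 M"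
  unfolding differentially_private_def
  using assms by (auto simp: measure_measure_pmf_finite sum_distrib_left intro!: sum_mono)

theorem theorem4p1:
  fixes adj :: "'d \<Rightarrow> 'd \<Rightarrow> bool"
    and M :: "nat \<Rightarrow> 'd \<Rightarrow> bool pmf"
    and K m :: nat and \<epsilon> :: real
  assumes "symp adj"
    and "K \<ge> 1" and "odd K"
    and "\<epsilon> \<ge> 0"
    and "m \<in> {1..K}"
    and dp: "\<And>i. i \<in> {1..K} \<Longrightarrow> differentially_private adj \<epsilon> 0 (M i)"
    and ident_distr: "\<And>i j D. i \<in> {1..K} \<Longrightarrow> j \<in> {1..K} \<Longrightarrow> M i D = M j D"
  shows "(\<forall>l\<in>{0..K}. subsample_noise K m l \<in> {0..1}) \<and>
         differentially_private adj (real m * \<epsilon>) 0 (darrm K (subsample_noise K m) M)"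
proof (intro conjI ballI differentially_privateI_pmf)
  \<comment> \<open>This ensures that clamping in \<open>bernoulli_pmf\<close> leaves the noise
    function unchanged.\<close>
  show "subsample_noise K m l \<in> {0..1}" if "l \<in> {0..K}" for l
    using that assms by (intro subsample_noise_bounds) auto
next
  fix D D' b
  assume "adj D D'"
  define t where "t = min m ((K + 1) div 2)"
  have pmf_darrm: "pmf (darrm K (subsample_noise K m) M D) b
      = binomial_tail (2 * t - 1) t (pmf (M 1 D) b)" for D
    unfolding t_def
  proof (rule pmf_darrm_subsample_noise)
    show "M i D = M 1 D" if "i \<in> {1..K}" for i
      using that \<open>K \<ge> 1\<close> by (intro ident_distr) auto
  qed (use \<open>odd K\<close> \<open>m \<in> {1..K}\<close> in auto)
  have dp1: "pmf (M 1 D) b \<le> exp \<epsilon> * pmf (M 1 D') b"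
    using \<open>K \<ge> 1\<close> \<open>adj D D'\<close> by (intro differentially_private_pmf[OF dp]) auto
  have "binomial_tail (2 * t - 1) t (pmf (M 1 D) b)
      \<le> exp \<epsilon> ^ t * binomial_tail (2 * t - 1) t (pmf (M 1 D') b)"
    using dp1 \<open>\<epsilon> \<ge> 0\<close> by (intro binomial_tail_le_power_mult') (auto simp: pmf_le_1)
  \<comment> \<open>The threshold satisfies \<open>t \<le> m\<close>, and
    \<open>exp \<epsilon>\<close> is at least 1.\<close>
  also have "\<dots> \<le> exp \<epsilon> ^ m * binomial_tail (2 * t - 1) t (pmf (M 1 D') b)"
    using \<open>\<epsilon> \<ge> 0\<close> by (intro mult_right_mono power_increasing) (auto simp: t_def)
  finally show "pmf (darrm K (subsample_noise K m) M D) b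
      \<le> exp (real m * \<epsilon>) * pmf (darrm K (subsample_noise K m) M D') b"
    by (simp add: pmf_darrm exp_of_nat_mult)
qed

end
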